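(* Let $\mathfrak{A}$ be a residuated lattice. The following assertions are equivalent: (1) $\mathfrak{A}$ is soft; (2) $Max_{h}(\mathfrak{A})$ is Hausdorff and $Max(\mathfrak{A})$ is dense in $Spec_{h}(\mathfrak{A})$; (3) $\mathfrak{A}$ is Gelfand and $Rad(\mathfrak{A})=\{1\}$.
   Context: A residuated lattice is an algebra $\mathfrak{A}=(A;\vee,\wedge,\odot,\rightarrow,0,1)$ such that $(A;\vee,\wedge,0,1)$ is a bounded lattice, $(A;\odot,1)$ is a commutative monoid, and $x\odot y\le z$ iff $x\le y\rightarrow z$ for all $x,y,z\in A$. A filter of $\mathfrak{A}$ is a non-empty subset $F\subseteq A$ such that $x,y\in F$ implies $x\odot y\in F$, and $x\in F$, $y\in A$ imply $x\vee y\in F$. A filter is proper if it is not $A$; a maximal filter is a maximal element (under inclusion) among proper filters; a prime filter is a proper filter $\mathfrak{p}$ such that $x\vee y\in\mathfrak{p}$ implies $x\in\mathfrak{p}$ or $y\in\mathfrak{p}$. $Spec(\mathfrak{A})$ and $Max(\mathfrak{A})$ are the sets of prime and maximal filters; $Max(\mathfrak{A})\subseteq Spec(\mathfrak{A})$. $\mathfrak{A}$ is Gelfand if every prime filter is contained in a unique maximal filter. $Rad(\mathfrak{A})$ is the intersection of all maximal filters of $\mathfrak{A}$ (equal to $A$ if there are none). $\mathfrak{A}$ is semisimple if $Rad(\mathfrak{A})=\{1\}$. For $X\subseteq A$, $h(X)=\{\mathfrak{p}\in Spec(\mathfrak{A})\mid X\subseteq\mathfrak{p}\}$, and $h(x)=h(\{x\})$.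 $\mathfrak{A}$ is soft if it is semisimple and every element of $h(Rad(\mathfrak{A}))$ is contained in a unique maximal filter of $\mathfrak{A}$. $Spec_h(\mathfrak{A})$ is $Spec(\mathfrak{A})$ with the hull-kernel topology, whose closed basis is $\{h(x)\mid x\in A\}$. $Max_h(\mathfrak{A})$ is $Max(\mathfrak{A})$ with the topology with closed basis $\{h(x)\cap Max(\mathfrak{A})\mid x\in A\}$ (the subspace topology). *)

theory Defs
  imports "HOL-Analysis.Analysis"
begin

text \<open>
  The underlying set of the residuated lattice is the whole type; \<open>sup\<close>, \<open>inf\<close>, \<open>*\<close>,
  \<open>residuum\<close>, \<open>bot\<close>, \<open>1\<close> play the roles of join, meet, product, implication, 0 and 1.
  The one-element algebra (\<open>bot = 1\<close>) is not excluded.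
\<close>

class residuated_lattice = bounded_lattice + comm_monoid_mult +
  fixes residuum :: "'a \<Rightarrow> 'a \<Rightarrow> 'a"
  assumes one_eq_top: "1 = top"
    and residuation: "x * y \<le> z \<longleftrightarrow> x \<le> residuum y z"

definition rl_filter :: "'a::residuated_lattice set \<Rightarrow> bool" where
  "rl_filter F \<longleftrightarrow> F \<noteq> {} \<and> (\<forall>x\<in>F. \<forall>y\<in>F. x * y \<in> F) \<and> (\<forall>x\<in>F. \<forall>y. sup x y \<in> F)"

definition proper_filter :: "'a::residuated_lattice set \<Rightarrow> bool" where
  "proper_filter F \<longleftrightarrow> rl_filter F \<and> F \<noteq> UNIV"

definition maximal_filter :: "'a::residuated_lattice set \<Rightarrow> bool" where
  "maximal_filter M \<longleftrightarrow> proper_filter M \<and> (\<forall>F. proper_filter F \<longrightarrow> M \<subseteq> F \<longrightarrow> F = M)"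

definition prime_filter :: "'a::residuated_lattice set \<Rightarrow> bool" where
  "prime_filter P \<longleftrightarrow> proper_filter P \<and> (\<forall>x y. sup x y \<in> P \<longrightarrow> x \<in> P \<or> y \<in> P)"

definition Spec :: "'a::residuated_lattice set set" where
  "Spec = {P. prime_filter P}"

definition MaxSpec :: "'a::residuated_lattice set set" where
  "MaxSpec = {M. maximal_filter M}"

text \<open>If there are no maximal filters, this intersection is \<open>UNIV\<close>, as intended.\<close>

definition Rad :: "'a::residuated_lattice set" where
  "Rad = \<Inter> MaxSpec"

definition hull_set :: "'a::residuated_lattice set \<Rightarrow> 'a set set" where
  "hull_set X = {P \<in> Spec. X \<subseteq> P}"

definition gelfand :: "'a::residuated_lattice itself \<Rightarrow> bool" where
  "gelfand _ \<longleftrightarrow> (\<forall>P \<in> (Spec :: 'a set set). \<exists>!M. M \<in> MaxSpec \<and> P \<subseteq> M)"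

definition semisimple :: "'a::residuated_lattice itself \<Rightarrow> bool" where
  "semisimple _ \<longleftrightarrow> Rad = ({1} :: 'a set)"

definition soft :: "'a::residuated_lattice itself \<Rightarrow> bool" where
  "soft T \<longleftrightarrow> semisimple T \<and>
     (\<forall>P \<in> hull_set (Rad :: 'a set). \<exists>!M. M \<in> MaxSpec \<and> P \<subseteq> M)"

definition Spec_h :: "'a::residuated_lattice set topology" where
  "Spec_h = topology_generated_by (range (\<lambda>x. Spec - hull_set {x}))"

definition Max_h :: "'a::residuated_lattice set topology" where
  "Max_h = subtopology Spec_h MaxSpec"

text \<open>
  The complements of the sets \<open>hull_set {x}\<close> are not merely a subbasis but a basis: the closed
  sets of \<open>Spec_h\<close> are exactly the intersections of sets \<open>hull_set {x}\<close> within \<open>Spec\<close>, and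
  those of \<open>Max_h\<close> are the intersections of sets \<open>hull_set {x} \<inter> MaxSpec\<close> within \<open>MaxSpec\<close>.
\<close>

lemma residuated_mult_mono:
  fixes a b c d :: "'a::residuated_lattice"
  assumes "a \<le> b" "c \<le> d"
  shows "a * c \<le> b * d"
proof -
  have *: "x * z \<le> y * z" if "x \<le> y" for x y z :: 'a
    using that residuation[of x z "y * z"] residuation[of y z "y * z"] by (meson order_refl order_trans)
  show ?thesis
    using *[OF assms(1), of c] *[OF assms(2), of b] by (metis mult.commute order_trans)
qed

lemma residuated_mult_le: "x * y \<le> (x::'a::residuated_lattice)"
proof -
  have "x * y \<le> x * 1" by (rule residuated_mult_mono) (simp_all add: one_eq_top)
  then show ?thesis by simp
qed

lemma residuated_mult_sup:
  "sup x y * z = sup (x * z) (y * (z::'a::residuated_lattice))"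
proof (rule antisym)
  show "sup x y * z \<le> sup (x * z) (y * z)"
    unfolding residuation by (rule sup_least) (simp_all flip: residuation)
  show "sup (x * z) (y * z) \<le> sup x y * z"
    by (simp add: residuated_mult_mono)
qed

lemma filter_upward: "rl_filter F \<Longrightarrow> x \<in> F \<Longrightarrow> x \<le> y \<Longrightarrow> y \<in> F"
  unfolding rl_filter_def by (metis sup.absorb2)

lemma bot_notin_proper_filter: "proper_filter F \<Longrightarrow> bot \<notin> F"
  unfolding proper_filter_def using filter_upward[of F bot] by auto

lemma MaxSpec_subset_Spec: "MaxSpec \<subseteq> Spec"
proof
  fix M :: "'a set" assume "M \<in> MaxSpec"
  then have M: "proper_filter M" and max: "\<And>F. proper_filter F \<Longrightarrow> M \<subseteq> F \<Longrightarrow> F = M"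
    by (auto simp: MaxSpec_def maximal_filter_def)
  have fil: "rl_filter M" using M by (simp add: proper_filter_def)
  have "x \<in> M \<or> y \<in> M" if xy: "sup x y \<in> M" for x y
  proof (rule ccontr)
    assume neg: "\<not> ?thesis"
    define G where "G = {z. sup z y \<in> M}"
    have "M \<subseteq> G" using fil by (auto simp: G_def rl_filter_def)
    have "z * w \<in> G" if "z \<in> G" "w \<in> G" for z w
    proof -
      have "sup z y * sup w y \<le> sup (z * w) y"
      proof -
        have "z * sup w y = sup (z * w) (y * z)"
          using residuated_mult_sup[of w y z] by (simp add: mult.commute)
        moreover have "y * z \<le> y" "y * sup w y \<le> y" by (rule residuated_mult_le)+
        ultimately show ?thesis
          by (simp add: residuated_mult_sup le_supI2)
      qed
      moreover have "sup z y * sup w y \<in> M"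
        using that fil by (auto simp: G_def rl_filter_def)
      ultimately show ?thesis using filter_upward[OF fil] by (simp add: G_def)
    qed
    moreover have "sup z w \<in> G" if "z \<in> G" for z w
      using that filter_upward[OF fil, of "sup z y" "sup (sup z w) y"]
      by (simp add: G_def le_supI1)
    ultimately have "rl_filter G"
      using \<open>M \<subseteq> G\<close> fil by (auto simp: rl_filter_def)
    moreover have "G \<noteq> UNIV"
    proof
      assume "G = UNIV"
      then have "bot \<in> G" by simp
      then show False using neg by (simp add: G_def)
    qed
    ultimately have "G = M" using max \<open>M \<subseteq> G\<close> by (simp add: proper_filter_def)
    then show False using neg xy by (auto simp: G_def)
  qed
  then show "M \<in> Spec" using M by (auto simp: Spec_def prime_filter_def)
qed

lemma hull_set_bot: "hull_set {bot} = {}"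
  by (auto simp: hull_set_def Spec_def prime_filter_def dest: bot_notin_proper_filter)

lemma hull_set_sup: "hull_set {sup x y} = hull_set {x} \<union> hull_set {y}"
proof -
  have "sup x y \<in> P \<longleftrightarrow> x \<in> P \<or> y \<in> P" if "P \<in> Spec" for P
    using that unfolding Spec_def prime_filter_def proper_filter_def
    by (auto intro: filter_upward[of P x] filter_upward[of P y])
  then show ?thesis by (auto simp: hull_set_def)
qed

lemma topspace_Spec_h [simp]: "topspace Spec_h = Spec"
  using hull_set_bot unfolding Spec_h_def topology_generated_by_topspace by (auto intro!: exI[of _ bot])

lemma topspace_Max_h [simp]: "topspace Max_h = MaxSpec"
  using MaxSpec_subset_Spec by (auto simp: Max_h_def)

lemma openin_Spec_h: "openin Spec_h U \<longleftrightarrow> (\<exists>X. U = (\<Union>x\<in>X. Spec - hull_set {x}))"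
proof
  assume "openin Spec_h U"
  then have "generate_topology_on (range (\<lambda>x. Spec - hull_set {x})) U"
    by (simp add: Spec_h_def openin_topology_generated_by)
  then show "\<exists>X. U = (\<Union>x\<in>X. Spec - hull_set {x})"
  proof (induction rule: generate_topology_on.induct)
    case Empty
    show ?case by (rule exI[of _ "{}"]) simp
  next
    case (Int U V)
    then obtain X Y where "U = (\<Union>x\<in>X. Spec - hull_set {x})" "V = (\<Union>y\<in>Y. Spec - hull_set {y})"
      by auto
    then have "U \<inter> V = (\<Union>z\<in>{sup x y |x y. x \<in> X \<and> y \<in> Y}. Spec - hull_set {z})"
      by (auto simp: hull_set_sup) (use hull_set_sup in blast)
    then show ?case by blast
  next
    case (UN K)
    then obtain X where X: "\<And>U. U \<in> K \<Longrightarrow> U = (\<Union>x\<in>X U. Spec - hull_set {x})"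
      by metis
    have "\<Union>K = (\<Union>U\<in>K. U)" by simp
    also have "\<dots> = (\<Union>U\<in>K. \<Union>x\<in>X U. Spec - hull_set {x})"
      by (rule SUP_cong[OF refl X])
    also have "\<dots> = (\<Union>x\<in>(\<Union>U\<in>K. X U). Spec - hull_set {x})"
      by auto
    finally have "\<Union>K = (\<Union>x\<in>(\<Union>U\<in>K. X U). Spec - hull_set {x})" .
    then show ?case by blast
  next
    case (Basis U)
    then obtain x where "U = Spec - hull_set {x}" by blast
    then show ?case by (intro exI[of _ "{x}"]) simp
  qed
next
  assume "\<exists>X. U = (\<Union>x\<in>X. Spec - hull_set {x})"
  then obtain X where "U = (\<Union>x\<in>X. Spec - hull_set {x})" ..
  moreover have "openin Spec_h (Spec - hull_set {x})" for x
    by (simp add: Spec_h_def topology_generated_by_Basis)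
  ultimately show "openin Spec_h U"
    by (metis (no_types, lifting) imageE openin_Union)
qed

lemma closedin_Spec_h: "closedin Spec_h C \<longleftrightarrow> (\<exists>X. C = Spec \<inter> (\<Inter>x\<in>X. hull_set {x}))"
proof -
  have "closedin Spec_h C \<longleftrightarrow> C \<subseteq> Spec \<and> (\<exists>X. Spec - C = (\<Union>x\<in>X. Spec - hull_set {x}))"
    by (simp add: closedin_def openin_Spec_h)
  also have "\<dots> \<longleftrightarrow> (\<exists>X. C = Spec \<inter> (\<Inter>x\<in>X. hull_set {x}))"
    by (intro iffI; elim conjE exE; (intro conjI)?; (rule exI)?) blast+
  finally show ?thesis .
qed

lemma closedin_Max_h:
  "closedin Max_h C \<longleftrightarrow> (\<exists>X. C = MaxSpec \<inter> (\<Inter>x\<in>X. hull_set {x} \<inter> MaxSpec))"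
proof -
  have "closedin Max_h C \<longleftrightarrow> (\<exists>X. C = (Spec \<inter> (\<Inter>x\<in>X. hull_set {x})) \<inter> MaxSpec)"
    unfolding Max_h_def closedin_subtopology closedin_Spec_h by blast
  also have "(\<lambda>X. (Spec \<inter> (\<Inter>x\<in>X. hull_set {x})) \<inter> MaxSpec) =
      (\<lambda>X. MaxSpec \<inter> (\<Inter>x\<in>X. hull_set {x :: 'a} \<inter> MaxSpec))"
    using MaxSpec_subset_Spec by (intro ext) blast
  finally show ?thesis .
qed

end

theory Submission
  imports Defs
begin

text \<open>
  Everything rests on one separation principle (\<open>prime_filter_avoiding\<close>): a filter disjoint from
  a non-empty join-closed set \<open>S\<close> extends to a prime filter that is still disjoint from \<open>S\<close>.

  The closure of \<open>MaxSpec\<close> in the hull-kernel topology consists of the primes containing \<open>Rad\<close>.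
  Since the intersection of all primes is \<open>{1}\<close> (separation from \<open>S = {x}\<close>), density of
  \<open>MaxSpec\<close> says exactly that \<open>Rad = {1}\<close>. In that case every prime contains \<open>Rad\<close>, so
  softness and the Gelfand property with trivial radical are the same condition.

  Two maximal filters \<open>M\<close> and \<open>N\<close> have disjoint neighbourhoods in \<open>Max_h\<close> iff there
  are \<open>x \<notin> M\<close> and \<open>y \<notin> N\<close> with \<open>sup x y \<in> Rad\<close>. A prime \<open>P \<subseteq> M \<inter> N\<close> containing
  \<open>Rad\<close> rules this out, because it would contain \<open>x\<close> or \<open>y\<close>; so a Hausdorff \<open>Max_h\<close> makes
  the maximal filter above such a prime unique. Conversely, if no such \<open>x\<close> and \<open>y\<close> exist, the
  joins \<open>sup x y\<close> with \<open>x \<notin> M\<close> and \<open>y \<notin> N\<close> form a join-closed set that misses \<open>1\<close>, and a prime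
  avoiding this set lies in both \<open>M\<close> and \<open>N\<close>, against the Gelfand property.
\<close>

section \<open>Extending filters\<close>

lemma rl_filter_one: "rl_filter F \<Longrightarrow> 1 \<in> F"
  using filter_upward[of F _ 1] by (auto simp: rl_filter_def one_eq_top)

lemma rl_filter_singleton_one: "rl_filter {1}"
  unfolding rl_filter_def by (simp add: one_eq_top[symmetric]) (simp add: one_eq_top)

lemma rl_filter_Union_chain:
  assumes "\<C> \<noteq> {}" and filters: "\<And>F. F \<in> \<C> \<Longrightarrow> rl_filter F"
    and chain: "subset.chain \<A> \<C>"
  shows "rl_filter (\<Union>\<C>)"
proof -
  have "x * y \<in> \<Union>\<C>" if "x \<in> F" "F \<in> \<C>" "y \<in> G" "G \<in> \<C>" for x y F G
  proof -
    have "F \<subseteq> G \<or> G \<subseteq> F"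
      using chain that by (auto simp: subset_chain_def)
    with that filters show ?thesis
      unfolding rl_filter_def by (meson UnionI subsetD)
  qed
  moreover have "\<Union>\<C> \<noteq> {}"
    using assms(1) filters by (fastforce simp: rl_filter_def)
  moreover have "sup x y \<in> \<Union>\<C>" if "x \<in> F" "F \<in> \<C>" for x y F
    using that filters unfolding rl_filter_def by blast
  ultimately show ?thesis
    unfolding rl_filter_def by blast
qed

lemma maximal_filter_avoiding_exists:
  fixes F :: "'a::residuated_lattice set"
  assumes "rl_filter F" "F \<inter> S = {}"
  obtains P where "rl_filter P" "F \<subseteq> P" "P \<inter> S = {}"
    "\<And>G. rl_filter G \<Longrightarrow> P \<subseteq> G \<Longrightarrow> G \<inter> S = {} \<Longrightarrow> G = P"
proof -
  let ?A = "{G. rl_filter G \<and> F \<subseteq> G \<and> G \<inter> S = {}}"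
  have "\<exists>P\<in>?A. \<forall>G\<in>?A. P \<subseteq> G \<longrightarrow> G = P"
  proof (rule subset_Zorn_nonempty)
    show "?A \<noteq> {}" using assms by blast
  next
    fix \<C> assume ne: "\<C> \<noteq> {}" and chain: "subset.chain ?A \<C>"
    then have sub: "\<C> \<subseteq> ?A" by (simp add: subset_chain_def)
    then have "rl_filter (\<Union>\<C>)"
      using rl_filter_Union_chain[OF ne _ chain] by blast
    with ne sub show "\<Union>\<C> \<in> ?A" by blast
  qed
  then obtain P where P: "P \<in> ?A" and max: "\<forall>G\<in>?A. P \<subseteq> G \<longrightarrow> G = P" by blast
  show thesis
  proof (rule that[of P])
    show "G = P" if "rl_filter G" "P \<subseteq> G" "G \<inter> S = {}" for G
      using P max that by blast
  qed (use P in auto)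
qed

text \<open>
  This set is the residual of \<open>F\<close> by \<open>b\<close> with respect to joins. It is the tool for proving
  primeness without describing generated filters: it contains \<open>F\<close>, and \<open>sup a b \<in> F\<close>
  just says that it contains \<open>a\<close>. Closure under products holds because
  \<open>sup z b * sup w b \<le> sup (z * w) b\<close>.
\<close>

lemma rl_filter_join_residual:
  fixes F :: "'a::residuated_lattice set"
  assumes F: "rl_filter F"
  shows "rl_filter {z. sup z b \<in> F}" and "F \<subseteq> {z. sup z b \<in> F}"
proof -
  show sub: "F \<subseteq> {z. sup z b \<in> F}"
    using F by (auto simp: rl_filter_def)
  have "sup (z * w) b \<in> F" if "sup z b \<in> F" "sup w b \<in> F" for z w
  proof (rule filter_upward[OF F])
    show "sup z b * sup w b \<in> F"
      using that F by (auto simp: rl_filter_def)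
    have "z * sup w b = sup (z * w) (b * z)"
      using residuated_mult_sup[of w b z] by (simp add: mult.commute)
    moreover have "b * z \<le> b" "b * sup w b \<le> b"
      by (rule residuated_mult_le)+
    ultimately show "sup z b * sup w b \<le> sup (z * w) b"
      by (simp add: residuated_mult_sup le_supI2)
  qed
  moreover have "sup (sup z w) b \<in> F" if "sup z b \<in> F" for z w
    using filter_upward[OF F that] by (simp add: le_supI1)
  ultimately show "rl_filter {z. sup z b \<in> F}"
    using sub F by (auto simp: rl_filter_def)
qed

text \<open>
  A filter \<open>P\<close> maximal among those avoiding \<open>S\<close> is prime. If \<open>sup a b \<in> P\<close> with \<open>a \<notin> P\<close>, then
  the join residual of \<open>P\<close> by \<open>b\<close> is strictly larger and hence contains some \<open>s \<in> S\<close>. Now the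
  residual by \<open>s\<close> contains \<open>b\<close>, and it avoids \<open>S\<close> because \<open>S\<close> is join-closed; so it is \<open>P\<close>.
\<close>

lemma prime_filter_avoiding:
  fixes F :: "'a::residuated_lattice set"
  assumes "rl_filter F" "F \<inter> S = {}" "S \<noteq> {}"
    and S: "\<And>s t. s \<in> S \<Longrightarrow> t \<in> S \<Longrightarrow> sup s t \<in> S"
  obtains P where "P \<in> Spec" "F \<subseteq> P" "P \<inter> S = {}"
proof -
  obtain P where P: "rl_filter P" "F \<subseteq> P" "P \<inter> S = {}"
    and max: "\<And>G. rl_filter G \<Longrightarrow> P \<subseteq> G \<Longrightarrow> G \<inter> S = {} \<Longrightarrow> G = P"
    using maximal_filter_avoiding_exists[OF assms(1,2)] by blast
  have "b \<in> P" if ab: "sup a b \<in> P" and "a \<notin> P" for a b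
  proof -
    have "{z. sup z b \<in> P} \<inter> S \<noteq> {}"
      using max[OF rl_filter_join_residual[OF P(1)], of b] that by blast
    then obtain s where s: "s \<in> S" "sup s b \<in> P" by blast
    then have "{z. sup z s \<in> P} \<inter> S = {}"
      using P(3) S by blast
    then have "{z. sup z s \<in> P} = P"
      using max[OF rl_filter_join_residual[OF P(1)]] by blast
    with s show "b \<in> P" by (auto simp: sup_commute)
  qed
  then have "P \<in> Spec"
    using P assms(3) by (auto simp: Spec_def prime_filter_def proper_filter_def)
  with P that show thesis by blast
qed

text \<open>
  A filter is proper iff it avoids \<open>bot\<close>, so maximal filters are the filters maximal among those
  avoiding \<open>{bot}\<close>.
\<close>

lemma proper_filter_le_maximal:
  assumes "proper_filter (F :: 'a::residuated_lattice set)"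
  obtains M where "M \<in> MaxSpec" "F \<subseteq> M"
proof -
  have "rl_filter F" "F \<inter> {bot} = {}"
    using assms bot_notin_proper_filter by (auto simp: proper_filter_def)
  then obtain M where M: "rl_filter M" "F \<subseteq> M" "M \<inter> {bot} = {}"
    and max: "\<And>G. rl_filter G \<Longrightarrow> M \<subseteq> G \<Longrightarrow> G \<inter> {bot} = {} \<Longrightarrow> G = M"
    using maximal_filter_avoiding_exists by blast
  have "G = M" if "proper_filter G" "M \<subseteq> G" for G
    using max[OF _ that(2)] bot_notin_proper_filter[OF that(1)] that(1)
    by (auto simp: proper_filter_def)
  then have "M \<in> MaxSpec"
    using M by (auto simp: MaxSpec_def maximal_filter_def proper_filter_def)
  with M that show thesis by blast
qed

section \<open>Density of the maximal filters\<close>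

lemma Inter_Spec: "\<Inter> Spec = ({1} :: 'a::residuated_lattice set)"
proof -
  have "x = 1" if "x \<in> \<Inter> Spec" for x :: 'a
  proof (rule ccontr)
    assume "x \<noteq> 1"
    then obtain P where "P \<in> Spec" "P \<inter> {x} = {}"
      using prime_filter_avoiding[OF rl_filter_singleton_one, of "{x}"] by auto
    with that show False by blast
  qed
  moreover have "1 \<in> P" if "P \<in> Spec" for P :: "'a set"
    using that rl_filter_one by (auto simp: Spec_def prime_filter_def proper_filter_def)
  ultimately show ?thesis by blast
qed

text \<open>
  A closed set consists of the primes containing some fixed \<open>X\<close>. It contains \<open>MaxSpec\<close> iff
  \<open>X \<subseteq> Rad\<close>, so the smallest one arises from \<open>X = Rad\<close>.
\<close>

lemma closure_of_MaxSpec: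
  "Spec_h closure_of MaxSpec = hull_set (Rad :: 'a::residuated_lattice set)"
proof
  have "hull_set (Rad :: 'a set) = Spec \<inter> (\<Inter>x\<in>Rad. hull_set {x})"
    by (auto simp: hull_set_def)
  then have "closedin Spec_h (hull_set (Rad :: 'a set))"
    unfolding closedin_Spec_h by blast
  moreover have "(MaxSpec :: 'a set set) \<subseteq> hull_set Rad"
    using MaxSpec_subset_Spec by (auto simp: hull_set_def Rad_def)
  ultimately show "Spec_h closure_of (MaxSpec :: 'a set set) \<subseteq> hull_set Rad"
    by (simp add: closure_of_minimal)
next
  obtain X :: "'a set" where
    X: "Spec_h closure_of (MaxSpec :: 'a set set) = Spec \<inter> (\<Inter>x\<in>X. hull_set {x})"
    using closedin_closure_of[of Spec_h "MaxSpec :: 'a set set"] unfolding closedin_Spec_h by blast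
  have "(MaxSpec :: 'a set set) \<subseteq> Spec_h closure_of (MaxSpec :: 'a set set)"
    using MaxSpec_subset_Spec by (intro closure_of_subset) simp
  then have "X \<subseteq> Rad"
    unfolding X by (auto simp: Rad_def hull_set_def)
  then show "hull_set (Rad :: 'a set) \<subseteq> Spec_h closure_of (MaxSpec :: 'a set set)"
    unfolding X by (auto simp: hull_set_def)
qed

lemma MaxSpec_dense_iff:
  "(Spec_h :: 'a::residuated_lattice set topology) closure_of MaxSpec = topspace Spec_h \<longleftrightarrow>
    Rad = ({1} :: 'a set)"
proof -
  have "1 \<in> (Rad :: 'a set)"
    using Inter_Spec[where 'a = 'a] MaxSpec_subset_Spec unfolding Rad_def by blast
  moreover have "hull_set (Rad :: 'a set) = Spec \<longleftrightarrow> (Rad :: 'a set) \<subseteq> \<Inter> (Spec :: 'a set set)"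
    by (auto simp: hull_set_def)
  ultimately show ?thesis
    unfolding closure_of_MaxSpec topspace_Spec_h Inter_Spec by blast
qed

section \<open>Separating maximal filters\<close>

text \<open>
  Disjoint neighbourhoods can be shrunk to the basic open sets of the maximal filters missing \<open>x\<close>
  and \<open>y\<close>; these are disjoint iff every maximal filter contains \<open>x\<close> or \<open>y\<close>, which by primeness
  means that it contains \<open>sup x y\<close>.
\<close>

lemma Hausdorff_Max_h_iff:
  "Hausdorff_space (Max_h :: 'a::residuated_lattice set topology) \<longleftrightarrow>
    (\<forall>M\<in>MaxSpec. \<forall>N\<in>MaxSpec. M \<noteq> N \<longrightarrow> (\<exists>x y :: 'a. x \<notin> M \<and> y \<notin> N \<and> sup x y \<in> Rad))"
  (is "_ \<longleftrightarrow> ?R")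
proof -
  define B where "B x = {M \<in> MaxSpec. x \<notin> M}" for x :: 'a
  have B: "B x = (Spec - hull_set {x}) \<inter> MaxSpec" for x
    using MaxSpec_subset_Spec by (auto simp: B_def hull_set_def)
  have "openin Spec_h (Spec - hull_set {x})" for x :: 'a
    unfolding openin_Spec_h by (intro exI[of _ "{x}"]) simp
  then have open_B: "openin Max_h (B x)" for x
    unfolding B Max_h_def by (auto simp: openin_subtopology)
  have basic: "\<exists>x. M \<in> B x \<and> B x \<subseteq> U" if U: "openin Max_h U" "M \<in> U" for M U
  proof -
    obtain X where "U = (\<Union>x\<in>X. Spec - hull_set {x}) \<inter> MaxSpec"
      using U(1) unfolding Max_h_def openin_subtopology openin_Spec_h by blast
    then have "U = (\<Union>x\<in>X. B x)" unfolding B by blast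
    with U(2) show ?thesis by blast
  qed
  have "sup x y \<in> M \<longleftrightarrow> x \<in> M \<or> y \<in> M" if "M \<in> MaxSpec" for x y and M :: "'a set"
    using that MaxSpec_subset_Spec hull_set_sup[of x y] by (auto simp: hull_set_def)
  then have disjoint_B: "disjnt (B x) (B y) \<longleftrightarrow> sup x y \<in> Rad" for x y
    by (auto simp: B_def Rad_def disjnt_def)
  show ?thesis
  proof
    assume H: "Hausdorff_space (Max_h :: 'a set topology)"
    show ?R
    proof (intro ballI impI)
      fix M N :: "'a set" assume MN: "M \<in> MaxSpec" "N \<in> MaxSpec" "M \<noteq> N"
      then obtain U V where UV: "openin Max_h U" "openin Max_h V" "M \<in> U" "N \<in> V" "disjnt U V"
        using H unfolding Hausdorff_space_def topspace_Max_h by blast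
      obtain x y where xy: "M \<in> B x" "B x \<subseteq> U" "N \<in> B y" "B y \<subseteq> V"
        using basic[OF UV(1,3)] basic[OF UV(2,4)] by blast
      then have "disjnt (B x) (B y)"
        using UV(5) by (auto simp: disjnt_def)
      then show "\<exists>x y. x \<notin> M \<and> y \<notin> N \<and> sup x y \<in> Rad"
        using xy unfolding disjoint_B by (auto simp: B_def)
    qed
  next
    assume R: ?R
    show "Hausdorff_space (Max_h :: 'a set topology)"
      unfolding Hausdorff_space_def topspace_Max_h
    proof (intro allI impI, elim conjE)
      fix M N :: "'a set" assume MN: "M \<in> MaxSpec" "N \<in> MaxSpec" "M \<noteq> N"
      then obtain x y where "x \<notin> M" "y \<notin> N" "sup x y \<in> Rad"
        using R by blast
      with MN have "M \<in> B x" "N \<in> B y" "disjnt (B x) (B y)"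
        unfolding disjoint_B by (auto simp: B_def)
      with open_B show "\<exists>U V. openin Max_h U \<and> openin Max_h V \<and> M \<in> U \<and> N \<in> V \<and> disjnt U V"
        by blast
    qed
  qed
qed

text \<open>
  In a Gelfand residuated lattice no prime lies below two different maximal filters, so the
  join-closed set of all \<open>sup x y\<close> with \<open>x \<notin> M\<close> and \<open>y \<notin> N\<close> has to contain \<open>1\<close>: a prime avoiding it
  would lie in both \<open>M\<close> and \<open>N\<close>, as \<open>x = sup x bot\<close> and \<open>y = sup bot y\<close> belong to it.
\<close>

lemma gelfand_separates_maximal:
  fixes M N :: "'a::residuated_lattice set"
  assumes "gelfand TYPE('a)" "M \<in> MaxSpec" "N \<in> MaxSpec" "M \<noteq> N"
  obtains x y where "x \<notin> M" "y \<notin> N" "sup x y = 1"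
proof (rule ccontr)
  assume "\<not> thesis"
  with that have no: "sup x y \<noteq> 1" if "x \<notin> M" "y \<notin> N" for x y
    using that by blast
  define S where "S = {sup x y |x y. x \<notin> M \<and> y \<notin> N}"
  have M: "prime_filter M" and N: "prime_filter N"
    using assms MaxSpec_subset_Spec by (auto simp: Spec_def)
  then have bot: "bot \<notin> M" "bot \<notin> N"
    by (auto simp: prime_filter_def dest: bot_notin_proper_filter)
  have in_S: "x \<in> S" if "x \<notin> M \<or> x \<notin> N" for x
    using that bot unfolding S_def by (metis (mono_tags, lifting) CollectI sup_bot.left_neutral
        sup_bot_right)
  have "sup s t \<in> S" if "s \<in> S" "t \<in> S" for s t
  proof -
    from that obtain x y x' y' where "s = sup x y" "t = sup x' y'"
      and notin: "x \<notin> M" "x' \<notin> M" "y \<notin> N" "y' \<notin> N"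
      unfolding S_def by blast
    then have "sup s t = sup (sup x x') (sup y y')"
      by (simp add: ac_simps)
    moreover have "sup x x' \<notin> M" "sup y y' \<notin> N"
      using notin M N by (auto simp: prime_filter_def)
    ultimately show ?thesis unfolding S_def by blast
  qed
  moreover have "{1} \<inter> S = {}" "S \<noteq> {}"
    using no bot in_S by (auto simp: S_def)
  ultimately obtain P where "P \<in> Spec" "P \<inter> S = {}"
    using prime_filter_avoiding[OF rl_filter_singleton_one] by metis
  with in_S have "P \<subseteq> M" "P \<subseteq> N" by blast+
  with \<open>P \<in> Spec\<close> assms show False
    unfolding gelfand_def by blast
qed

lemma Hausdorff_Max_h_imp_unique_maximal:
  fixes P :: "'a::residuated_lattice set"
  assumes "Hausdorff_space (Max_h :: 'a set topology)" "P \<in> hull_set Rad"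
  shows "\<exists>!M. M \<in> MaxSpec \<and> P \<subseteq> M"
proof -
  have P: "prime_filter P" "Rad \<subseteq> P"
    using assms(2) by (auto simp: hull_set_def Spec_def)
  then have "\<exists>M. M \<in> MaxSpec \<and> P \<subseteq> M"
    using proper_filter_le_maximal by (metis prime_filter_def)
  moreover have "M = N" if MN: "M \<in> MaxSpec" "P \<subseteq> M" "N \<in> MaxSpec" "P \<subseteq> N" for M N
  proof (rule ccontr)
    assume "M \<noteq> N"
    then obtain x y where "x \<notin> M" "y \<notin> N" "sup x y \<in> Rad"
      using assms(1) MN unfolding Hausdorff_Max_h_iff by blast
    with P MN show False unfolding prime_filter_def by blast
  qed
  ultimately show ?thesis by blast
qed

section \<open>Characterisations of softness\<close>

lemma soft_iff_gelfand:
  "soft TYPE('a::residuated_lattice) \<longleftrightarrow> gelfand TYPE('a) \<and> Rad = ({1} :: 'a set)"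
proof -
  have "hull_set (Rad :: 'a set) = (Spec :: 'a set set)" if "Rad = ({1} :: 'a set)"
    using that MaxSpec_dense_iff[where 'a = 'a] by (simp add: closure_of_MaxSpec)
  then show ?thesis
    unfolding soft_def semisimple_def gelfand_def by metis
qed

theorem theorem3p17:
  shows "(soft TYPE('a::residuated_lattice) \<longleftrightarrow>
            Hausdorff_space (Max_h :: 'a set topology) \<and>
            (Spec_h :: 'a set topology) closure_of MaxSpec = topspace Spec_h)
       \<and> (soft TYPE('a) \<longleftrightarrow> gelfand TYPE('a) \<and> Rad = ({1} :: 'a set))"
proof (intro conjI soft_iff_gelfand iffI)
  assume "soft TYPE('a)"
  then have G: "gelfand TYPE('a)" and Rad: "Rad = ({1} :: 'a set)"
    by (simp_all add: soft_iff_gelfand)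
  show "Hausdorff_space (Max_h :: 'a set topology)"
    unfolding Hausdorff_Max_h_iff Rad using gelfand_separates_maximal[OF G] by (metis singletonI)
  show "(Spec_h :: 'a set topology) closure_of MaxSpec = topspace Spec_h"
    using Rad by (simp only: MaxSpec_dense_iff)
next
  assume "Hausdorff_space (Max_h :: 'a set topology) \<and>
    (Spec_h :: 'a set topology) closure_of MaxSpec = topspace Spec_h"
  then show "soft TYPE('a)"
    unfolding soft_def semisimple_def MaxSpec_dense_iff
    using Hausdorff_Max_h_imp_unique_maximal by blast
qed

end
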